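(* Let $R$ be a finite Frobenius ring with unity (not assumed commutative), let $n$ be a positive integer, and let $C$ and $D$ be two linear codes in $R^n$ (i.e. right $R$-submodules of $R^n$). Then the pair $(C,D)$ is LCP if and only if $C$ and $D$ are both injective right $R$-modules and $E(C\oplus D)=R^n$.
   Context: A finite ring $R$ is Frobenius if it is right and left self-injective and $R/J(R)\cong \mathrm{Soc}(R)$ as right $R$-modules, where $J(R)$ is the Jacobson radical. A linear code of length $n$ over $R$ is a right $R$-submodule of $R^n$. The pair $(C,D)$ is LCP (a linear complementary pair) if $C\oplus D=R^n$, i.e. $C+D=R^n$ and $C\cap D=\{0\}$. Writing $C\oplus D$ for submodules $C,D$ of $R^n$ means the internal direct sum, so it includes the assertion $C\cap D=\{0\}$. A submodule $A$ of a right $R$-module $I$ is essential in $I$ if $A\cap M\neq 0$ for every nonzero right $R$-submodule $M$ of $I$. A right $R$-submodule $I$ of $R^n$ is an injective hull of a right $R$-submodule $A$, written $E(A)=I$, if $I$ is an injective right $R$-module and $A$ is an essential submodule of $I$. Thus $E(C\oplus D)=R^n$ means that $C\cap D=\{0\}$, $R^n$ is injective, and $C+D$ is an essential submodule of $R^n$. *)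

theory Defs
  imports "HOL-Algebra.QuotRing" "HOL-Algebra.Module" "HOL-Library.Infinite_Typeclass"
begin

text \<open>
  HOL-Algebra's locale \<open>module\<close> assumes a commutative ring of scalars.  Its record type and its
  locale \<open>submodule\<close> (a subgroup closed under scalars) do not, and are reused here.  For a right
  module, \<open>a \<odot>\<^bsub>M\<^esub> x\<close> is to be read as \<open>x a\<close>; hence the order in \<open>smult_assoc\<close>.  The
  fields \<open>mult\<close> and \<open>one\<close> that the record inherits from rings play no role.
\<close>

locale right_module = R?: ring R + M?: abelian_group M
  for R (structure) and M (structure) +
  assumes smult_closed: "\<lbrakk>a \<in> carrier R; x \<in> carrier M\<rbrakk> \<Longrightarrow> a \<odot>\<^bsub>M\<^esub> x \<in> carrier M"
    and smult_l_distr: "\<lbrakk>a \<in> carrier R; b \<in> carrier R; x \<in> carrier M\<rbrakk> \<Longrightarrow>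
      (a \<oplus> b) \<odot>\<^bsub>M\<^esub> x = a \<odot>\<^bsub>M\<^esub> x \<oplus>\<^bsub>M\<^esub> b \<odot>\<^bsub>M\<^esub> x"
    and smult_r_distr: "\<lbrakk>a \<in> carrier R; x \<in> carrier M; y \<in> carrier M\<rbrakk> \<Longrightarrow>
      a \<odot>\<^bsub>M\<^esub> (x \<oplus>\<^bsub>M\<^esub> y) = a \<odot>\<^bsub>M\<^esub> x \<oplus>\<^bsub>M\<^esub> a \<odot>\<^bsub>M\<^esub> y"
    and smult_assoc: "\<lbrakk>a \<in> carrier R; b \<in> carrier R; x \<in> carrier M\<rbrakk> \<Longrightarrow>
      (a \<otimes> b) \<odot>\<^bsub>M\<^esub> x = b \<odot>\<^bsub>M\<^esub> (a \<odot>\<^bsub>M\<^esub> x)"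
    and smult_one: "x \<in> carrier M \<Longrightarrow> \<one> \<odot>\<^bsub>M\<^esub> x = x"

definition submod :: "('a, 'b, 'c) module_scheme \<Rightarrow> 'b set \<Rightarrow> ('a, 'b, 'c) module_scheme"
  where "submod M H = M\<lparr>carrier := H\<rparr>"

definition quot_mod :: "('a, 'b, 'c) module_scheme \<Rightarrow> 'b set \<Rightarrow> ('a, 'b set) module"
  where "quot_mod M N =
    \<lparr>carrier = a_rcosets\<^bsub>M\<^esub> N, mult = rcoset_mult M N, one = N +>\<^bsub>M\<^esub> \<one>\<^bsub>M\<^esub>,
     zero = N, add = set_add M, smult = (\<lambda>a X. \<Union>x\<in>X. N +>\<^bsub>M\<^esub> (a \<odot>\<^bsub>M\<^esub> x))\<rparr>"

definition rmod_hom ::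
    "('a, 'r) ring_scheme \<Rightarrow> ('a, 'b, 'm) module_scheme \<Rightarrow> ('a, 'c, 'n) module_scheme \<Rightarrow> ('b \<Rightarrow> 'c) set"
  where "rmod_hom R M N =
    {h \<in> carrier M \<rightarrow> carrier N.
       (\<forall>x\<in>carrier M. \<forall>y\<in>carrier M. h (x \<oplus>\<^bsub>M\<^esub> y) = h x \<oplus>\<^bsub>N\<^esub> h y) \<and>
       (\<forall>a\<in>carrier R. \<forall>x\<in>carrier M. h (a \<odot>\<^bsub>M\<^esub> x) = a \<odot>\<^bsub>N\<^esub> h x)}"

definition rmod_isomorphic ::
    "('a, 'r) ring_scheme \<Rightarrow> ('a, 'b, 'm) module_scheme \<Rightarrow> ('a, 'c, 'n) module_scheme \<Rightarrow> bool"
  where "rmod_isomorphic R M N \<longleftrightarrow> (\<exists>h\<in>rmod_hom R M N. bij_betw h (carrier M) (carrier N))"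

text \<open>
  HOL cannot quantify over all types inside a formula, so the modules \<open>A\<close>, \<open>B\<close> of the extension
  property range over those whose elements belong to a type \<open>'u\<close>, given as a parameter.  The sort
  constraint keeps \<open>'u\<close> from being too small: every finite module over \<open>R\<close> has an isomorphic copy
  in an infinite \<open>'u\<close>.  If \<open>R\<close> is finite, this applies to \<open>R\<close> and to all its right ideals, so by
  Baer's criterion the property is full injectivity and does not depend on \<open>'u\<close>.
\<close>

definition injective_rmod ::
    "'u::infinite itself \<Rightarrow> ('a, 'r) ring_scheme \<Rightarrow> ('a, 'b, 'm) module_scheme \<Rightarrow> bool"
  where "injective_rmod U R I \<longleftrightarrow> right_module R I \<and>
    (\<forall>(A :: ('a, 'u) module) (B :: ('a, 'u) module) f g.
       right_module R A \<and> right_module R B \<and>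
       f \<in> rmod_hom R A B \<and> inj_on f (carrier A) \<and> g \<in> rmod_hom R A I \<longrightarrow>
       (\<exists>h\<in>rmod_hom R B I. \<forall>x\<in>carrier A. h (f x) = g x))"

definition essential_submodule ::
    "('a, 'r) ring_scheme \<Rightarrow> 'b set \<Rightarrow> ('a, 'b, 'm) module_scheme \<Rightarrow> bool"
  where "essential_submodule R A I \<longleftrightarrow> submodule A R I \<and>
    (\<forall>M. submodule M R I \<and> M \<noteq> {\<zero>\<^bsub>I\<^esub>} \<longrightarrow> A \<inter> M \<noteq> {\<zero>\<^bsub>I\<^esub>})"

definition injective_hull ::
    "'u::infinite itself \<Rightarrow> ('a, 'r) ring_scheme \<Rightarrow> 'b set \<Rightarrow> ('a, 'b, 'm) module_scheme \<Rightarrow> bool"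
  where "injective_hull U R A I \<longleftrightarrow> injective_rmod U R I \<and> essential_submodule R A I"

definition regular_rmod :: "('a, 'r) ring_scheme \<Rightarrow> ('a, 'a) module"
  where "regular_rmod R =
    \<lparr>carrier = carrier R, mult = mult R, one = one R, zero = zero R, add = add R,
     smult = (\<lambda>a x. x \<otimes>\<^bsub>R\<^esub> a)\<rparr>"

text \<open>Left modules over \<open>R\<close> are right modules over \<open>opposite_ring R\<close>.\<close>

definition opposite_ring :: "('a, 'r) ring_scheme \<Rightarrow> ('a, 'r) ring_scheme"
  where "opposite_ring R = R\<lparr>mult := (\<lambda>x y. y \<otimes>\<^bsub>R\<^esub> x)\<rparr>"

definition right_self_injective :: "'u::infinite itself \<Rightarrow> ('a, 'r) ring_scheme \<Rightarrow> bool"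
  where "right_self_injective U R \<longleftrightarrow> injective_rmod U R (regular_rmod R)"

definition left_self_injective :: "'u::infinite itself \<Rightarrow> ('a, 'r) ring_scheme \<Rightarrow> bool"
  where "left_self_injective U R \<longleftrightarrow> right_self_injective U (opposite_ring R)"

definition right_ideal :: "('a, 'r) ring_scheme \<Rightarrow> 'a set \<Rightarrow> bool"
  where "right_ideal R I \<longleftrightarrow> submodule I R (regular_rmod R)"

definition maximal_right_ideal :: "('a, 'r) ring_scheme \<Rightarrow> 'a set \<Rightarrow> bool"
  where "maximal_right_ideal R I \<longleftrightarrow> right_ideal R I \<and> I \<noteq> carrier R \<and>
    (\<forall>J. right_ideal R J \<and> I \<subseteq> J \<longrightarrow> J = I \<or> J = carrier R)"

definition minimal_right_ideal :: "('a, 'r) ring_scheme \<Rightarrow> 'a set \<Rightarrow> bool"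
  where "minimal_right_ideal R I \<longleftrightarrow> right_ideal R I \<and> I \<noteq> {\<zero>\<^bsub>R\<^esub>} \<and>
    (\<forall>J. right_ideal R J \<and> J \<subseteq> I \<longrightarrow> J = {\<zero>\<^bsub>R\<^esub>} \<or> J = I)"

text \<open>The intersection with the carrier matters only for the zero ring, where there are no maximal right ideals.\<close>

definition jacobson_radical :: "('a, 'r) ring_scheme \<Rightarrow> 'a set"
  where "jacobson_radical R = carrier R \<inter> \<Inter>{I. maximal_right_ideal R I}"

text \<open>The sum of all minimal right ideals, as the smallest right ideal containing each of them.\<close>

definition right_socle :: "('a, 'r) ring_scheme \<Rightarrow> 'a set"
  where "right_socle R = \<Inter>{H. right_ideal R H \<and> (\<forall>I. minimal_right_ideal R I \<longrightarrow> I \<subseteq> H)}"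

definition finite_frobenius_ring :: "'u::infinite itself \<Rightarrow> ('a, 'r) ring_scheme \<Rightarrow> bool"
  where "finite_frobenius_ring U R \<longleftrightarrow> ring R \<and> finite (carrier R) \<and>
    right_self_injective U R \<and> left_self_injective U R \<and>
    rmod_isomorphic R (quot_mod (regular_rmod R) (jacobson_radical R))
                      (submod (regular_rmod R) (right_socle R))"

definition free_rmod :: "('a, 'r) ring_scheme \<Rightarrow> nat \<Rightarrow> ('a, nat \<Rightarrow> 'a) module"
  where "free_rmod R n =
    \<lparr>carrier = {..<n} \<rightarrow>\<^sub>E carrier R,
     mult = (\<lambda>x y. \<lambda>i\<in>{..<n}. x i \<otimes>\<^bsub>R\<^esub> y i), one = (\<lambda>i\<in>{..<n}. \<one>\<^bsub>R\<^esub>),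
     zero = (\<lambda>i\<in>{..<n}. \<zero>\<^bsub>R\<^esub>), add = (\<lambda>x y. \<lambda>i\<in>{..<n}. x i \<oplus>\<^bsub>R\<^esub> y i),
     smult = (\<lambda>a x. \<lambda>i\<in>{..<n}. x i \<otimes>\<^bsub>R\<^esub> a)\<rparr>"

definition linear_code :: "('a, 'r) ring_scheme \<Rightarrow> nat \<Rightarrow> (nat \<Rightarrow> 'a) set \<Rightarrow> bool"
  where "linear_code R n C \<longleftrightarrow> submodule C R (free_rmod R n)"

definition LCP :: "('a, 'r) ring_scheme \<Rightarrow> nat \<Rightarrow> (nat \<Rightarrow> 'a) set \<Rightarrow> (nat \<Rightarrow> 'a) set \<Rightarrow> bool"
  where "LCP R n C D \<longleftrightarrow>
    C <+>\<^bsub>free_rmod R n\<^esub> D = carrier (free_rmod R n) \<and> C \<inter> D = {\<zero>\<^bsub>free_rmod R n\<^esub>}"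

lemma ring_opposite_ring:
  assumes "ring R" shows "ring (opposite_ring R)"
proof -
  interpret ring R by fact
  have "abelian_group (opposite_ring R)"
    by (rule abelian_groupI)
      (auto simp: opposite_ring_def a_assoc a_comm a_lcomm intro!: bexI[of _ "\<ominus>\<^bsub>R\<^esub> _"] l_neg)
  moreover have "monoid (opposite_ring R)"
    by (rule monoidI) (auto simp: opposite_ring_def m_assoc)
  ultimately show ?thesis
    by (rule ringI) (auto simp: opposite_ring_def l_distr r_distr)
qed

lemma right_module_regular_rmod:
  assumes "ring R" shows "right_module R (regular_rmod R)"
proof -
  interpret ring R by fact
  have "abelian_group (regular_rmod R)"
    by (rule abelian_groupI)
      (auto simp: regular_rmod_def a_assoc a_comm a_lcomm intro!: bexI[of _ "\<ominus>\<^bsub>R\<^esub> _"] l_neg)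
  then show ?thesis
    by (intro right_module.intro right_module_axioms.intro assms)
      (auto simp: regular_rmod_def m_assoc l_distr r_distr)
qed

lemma right_module_free_rmod:
  assumes "ring R" shows "right_module R (free_rmod R n)"
proof -
  interpret ring R by fact
  have "abelian_group (free_rmod R n)"
  proof (rule abelian_groupI)
    fix x assume x: "x \<in> carrier (free_rmod R n)"
    then have *: "\<And>i. i < n \<Longrightarrow> x i \<in> carrier R" by (auto simp: free_rmod_def)
    then show "\<exists>y\<in>carrier (free_rmod R n). y \<oplus>\<^bsub>free_rmod R n\<^esub> x = \<zero>\<^bsub>free_rmod R n\<^esub>"
      by (intro bexI[of _ "\<lambda>i\<in>{..<n}. \<ominus>\<^bsub>R\<^esub> x i"])
        (auto simp: free_rmod_def fun_eq_iff l_neg)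
  qed (auto simp: free_rmod_def PiE_iff fun_eq_iff a_assoc a_comm a_lcomm extensional_def)
  then show ?thesis
    by (intro right_module.intro right_module_axioms.intro assms)
      (auto simp: free_rmod_def PiE_iff fun_eq_iff m_assoc l_distr r_distr extensional_def)
qed

lemma right_module_submod:
  fixes R (structure) and M (structure)
  assumes "right_module R M" "submodule H R M" shows "right_module R (submod M H)"
proof -
  interpret right_module R M by fact
  interpret H: submodule H R M by fact
  have H: "\<And>x. x \<in> H \<Longrightarrow> x \<in> carrier M" using H.subset by auto
  have "abelian_group (submod M H)"
  proof (rule abelian_groupI)
    fix x assume x: "x \<in> carrier (submod M H)"
    then have "x \<in> H" by (simp add: submod_def)
    then have "\<ominus>\<^bsub>M\<^esub> x \<in> H" using H.m_inv_closed by (simp add: a_inv_def)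
    with \<open>x \<in> H\<close> show "\<exists>y\<in>carrier (submod M H). y \<oplus>\<^bsub>submod M H\<^esub> x = \<zero>\<^bsub>submod M H\<^esub>"
      by (intro bexI[of _ "\<ominus>\<^bsub>M\<^esub> x"]) (auto simp: submod_def H M.l_neg)
  qed (use H.m_closed H.one_closed in \<open>auto simp: submod_def H M.a_assoc M.a_comm M.a_lcomm\<close>)
  then show ?thesis
    by (intro right_module.intro right_module_axioms.intro R.ring_axioms)
      (auto simp: submod_def H smult_l_distr smult_r_distr smult_assoc smult_one H.smult_closed)
qed

lemma quot_mod_smult_coset:
  fixes R (structure) and M (structure)
  assumes "right_module R M" "submodule N R M" "a \<in> carrier R" "x \<in> carrier M"
  shows "a \<odot>\<^bsub>quot_mod M N\<^esub> (N +>\<^bsub>M\<^esub> x) = N +>\<^bsub>M\<^esub> (a \<odot>\<^bsub>M\<^esub> x)"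
proof -
  interpret right_module R M by fact
  interpret N: submodule N R M by fact
  interpret N: abelian_subgroup N M
    by (intro abelian_subgroupI3 additive_subgroup.intro N.subgroup_axioms M.abelian_group_axioms)
  have "N +>\<^bsub>M\<^esub> (a \<odot>\<^bsub>M\<^esub> (h \<oplus>\<^bsub>M\<^esub> x)) = N +>\<^bsub>M\<^esub> (a \<odot>\<^bsub>M\<^esub> x)" if "h \<in> N" for h
  proof -
    have "h \<in> carrier M" using that N.a_subset by auto
    then have "a \<odot>\<^bsub>M\<^esub> (h \<oplus>\<^bsub>M\<^esub> x) = a \<odot>\<^bsub>M\<^esub> h \<oplus>\<^bsub>M\<^esub> a \<odot>\<^bsub>M\<^esub> x"
      using assms by (simp add: smult_r_distr)
    then have "a \<odot>\<^bsub>M\<^esub> (h \<oplus>\<^bsub>M\<^esub> x) \<in> N +>\<^bsub>M\<^esub> (a \<odot>\<^bsub>M\<^esub> x)"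
      using N.smult_closed[OF assms(3) that] by (auto simp: a_r_coset_def')
    then show ?thesis
      by (metis N.a_repr_independence' assms(3,4) smult_closed)
  qed
  moreover have "N \<noteq> {}" using N.zero_closed by blast
  ultimately show ?thesis
    by (simp add: quot_mod_def a_r_coset_def'[of M N x])
qed

lemma right_module_quot_mod:
  fixes R (structure) and M (structure)
  assumes M: "right_module R M" and N: "submodule N R M" shows "right_module R (quot_mod M N)"
proof -
  interpret right_module R M by fact
  interpret N: submodule N R M by fact
  interpret N: abelian_subgroup N M
    by (intro abelian_subgroupI3 additive_subgroup.intro N.subgroup_axioms M.abelian_group_axioms)
  have carr: "carrier (quot_mod M N) = (\<lambda>x. N +>\<^bsub>M\<^esub> x) ` carrier M"
    by (auto simp: quot_mod_def A_RCOSETS_def')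
  have add: "(N +>\<^bsub>M\<^esub> x) \<oplus>\<^bsub>quot_mod M N\<^esub> (N +>\<^bsub>M\<^esub> y) = N +>\<^bsub>M\<^esub> (x \<oplus>\<^bsub>M\<^esub> y)"
    if "x \<in> carrier M" "y \<in> carrier M" for x y
    using that by (simp add: quot_mod_def N.a_rcos_sum)
  have "abelian_group (quot_mod M N)"
  proof (rule abelian_groupI)
    have zero: "\<zero>\<^bsub>quot_mod M N\<^esub> = N +>\<^bsub>M\<^esub> \<zero>\<^bsub>M\<^esub>"
      using M.a_coset_add_zero N.a_subset by (simp add: quot_mod_def)
    show "\<zero>\<^bsub>quot_mod M N\<^esub> \<in> carrier (quot_mod M N)"
      by (simp add: carr zero)
    fix X assume "X \<in> carrier (quot_mod M N)"
    then obtain x where x: "x \<in> carrier M" "X = N +>\<^bsub>M\<^esub> x" by (auto simp: carr)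
    then show "\<zero>\<^bsub>quot_mod M N\<^esub> \<oplus>\<^bsub>quot_mod M N\<^esub> X = X" by (simp add: zero add)
    show "\<exists>Y\<in>carrier (quot_mod M N). Y \<oplus>\<^bsub>quot_mod M N\<^esub> X = \<zero>\<^bsub>quot_mod M N\<^esub>"
      using x by (intro bexI[of _ "N +>\<^bsub>M\<^esub> (\<ominus>\<^bsub>M\<^esub> x)"]) (auto simp: carr zero add M.l_neg)
  qed (auto simp: carr add M.a_assoc M.a_comm M.a_lcomm)
  then show ?thesis
    by (intro right_module.intro right_module_axioms.intro R.ring_axioms)
      (auto simp: carr add quot_mod_smult_coset[OF M N] smult_closed
        smult_l_distr smult_r_distr smult_assoc smult_one)
qed

end

(*
  For the forward direction, R^n is a power of the self-injective module R, hence injective, and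
  direct summands of injective modules are injective.  Conversely, if C and D are injective and
  independent, the two projections of C + D extend to R^n; the sum of the extensions is a
  retraction of R^n onto C + D, whose kernel meets C + D trivially and so vanishes by essentiality.
*)
theory Submission
  imports Defs
begin

section \<open>Homomorphisms and submodules\<close>

lemma submod_carrier [simp]: "carrier (submod M H) = H"
  by (simp add: submod_def)

lemma submod_ops [simp]:
  "add (submod M H) = add M" "smult (submod M H) = smult M" "zero (submod M H) = zero M"
  by (simp_all add: submod_def)

lemma submod_carrier_self [simp]: "submod M (carrier M) = M"
  by (simp add: submod_def)

lemma set_add_eq: "C <+>\<^bsub>M\<^esub> D = {c \<oplus>\<^bsub>M\<^esub> d |c d. c \<in> C \<and> d \<in> D}"
  by (auto simp: set_add_def')

lemma rmod_hom_comp: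
  assumes "f \<in> rmod_hom R A B" "g \<in> rmod_hom R B C"
  shows "(\<lambda>x. g (f x)) \<in> rmod_hom R A C"
  using assms by (auto simp: rmod_hom_def Pi_iff)

lemma rmod_hom_submod_mono:
  assumes "f \<in> rmod_hom R A (submod M H)" "H \<subseteq> carrier M"
  shows "f \<in> rmod_hom R A M"
  using assms by (auto simp: rmod_hom_def)

section \<open>Submodules of a right module and projections of direct sums\<close>

context right_module
begin

text \<open>\<open>submodule\<close> asks for an additive subgroup, hence for closure under
  negatives. Over a ring with unity this follows from closure under scalars, because -x is x acted
  on by -1.\<close>

lemma right_submoduleI:
  assumes "H \<subseteq> carrier M" "\<zero>\<^bsub>M\<^esub> \<in> H"
    and "\<And>x y. \<lbrakk>x \<in> H; y \<in> H\<rbrakk> \<Longrightarrow> x \<oplus>\<^bsub>M\<^esub> y \<in> H"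
    and "\<And>a x. \<lbrakk>a \<in> carrier R; x \<in> H\<rbrakk> \<Longrightarrow> a \<odot>\<^bsub>M\<^esub> x \<in> H"
  shows "submodule H R M"
proof -
  have neg: "\<ominus>\<^bsub>M\<^esub> x = (\<ominus> \<one>) \<odot>\<^bsub>M\<^esub> x" if x: "x \<in> carrier M" for x
  proof -
    \<comment> \<open>In a group an element equal to its own double is zero. This gives x0 = 0,
      which then identifies the action of -1 with negation.\<close>
    have "\<zero> \<odot>\<^bsub>M\<^esub> x \<oplus>\<^bsub>M\<^esub> \<zero> \<odot>\<^bsub>M\<^esub> x = \<zero> \<odot>\<^bsub>M\<^esub> x"
      using smult_l_distr[OF R.zero_closed R.zero_closed x] by simp
    then have "\<zero> \<odot>\<^bsub>M\<^esub> x = \<zero>\<^bsub>M\<^esub>"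
      using smult_closed[OF R.zero_closed x] by (simp add: M.add.l_cancel_one)
    moreover have "(\<ominus> \<one>) \<odot>\<^bsub>M\<^esub> x \<oplus>\<^bsub>M\<^esub> x = (\<ominus> \<one> \<oplus> \<one>) \<odot>\<^bsub>M\<^esub> x"
      using x by (simp add: smult_l_distr smult_one)
    ultimately show ?thesis
      using x smult_closed[of "\<ominus> \<one>" x] by (intro M.minus_equality) (auto simp: R.l_neg)
  qed
  have "subgroup H (add_monoid M)"
    using assms neg by (intro M.add.subgroupI) (auto simp: a_inv_def[symmetric] subset_iff)
  then show ?thesis
    using assms by (intro submodule.intro submodule_axioms.intro) auto
qed

lemma submodule_carrier: "submodule (carrier M) R M"
  by (rule right_submoduleI) (auto simp: smult_closed)

lemma submodule_add:
  assumes "submodule C R M" "submodule D R M"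
  shows "submodule (C <+>\<^bsub>M\<^esub> D) R M"
proof -
  interpret C: submodule C R M by fact
  interpret D: submodule D R M by fact
  note carr = C.subset[THEN subsetD, simplified] D.subset[THEN subsetD, simplified]
  show ?thesis
  proof (rule right_submoduleI)
    show "C <+>\<^bsub>M\<^esub> D \<subseteq> carrier M" by (auto simp: set_add_eq carr)
    show "\<zero>\<^bsub>M\<^esub> \<in> C <+>\<^bsub>M\<^esub> D"
      using C.one_closed D.one_closed M.l_zero[OF M.zero_closed] by (force simp: set_add_eq)
  next
    fix x y assume "x \<in> C <+>\<^bsub>M\<^esub> D" "y \<in> C <+>\<^bsub>M\<^esub> D"
    then obtain c d c' d' where *: "c \<in> C" "d \<in> D" "c' \<in> C" "d' \<in> D"
      "x = c \<oplus>\<^bsub>M\<^esub> d" "y = c' \<oplus>\<^bsub>M\<^esub> d'" by (auto simp: set_add_eq)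
    then have "x \<oplus>\<^bsub>M\<^esub> y = (c \<oplus>\<^bsub>M\<^esub> c') \<oplus>\<^bsub>M\<^esub> (d \<oplus>\<^bsub>M\<^esub> d')"
      by (simp add: carr M.a_ac)
    moreover have "c \<oplus>\<^bsub>M\<^esub> c' \<in> C" "d \<oplus>\<^bsub>M\<^esub> d' \<in> D"
      using * C.m_closed D.m_closed by auto
    ultimately show "x \<oplus>\<^bsub>M\<^esub> y \<in> C <+>\<^bsub>M\<^esub> D" by (auto simp: set_add_eq)
  next
    fix a x assume a: "a \<in> carrier R" and "x \<in> C <+>\<^bsub>M\<^esub> D"
    then obtain c d where *: "c \<in> C" "d \<in> D" "x = c \<oplus>\<^bsub>M\<^esub> d" by (auto simp: set_add_eq)
    then have "a \<odot>\<^bsub>M\<^esub> x = a \<odot>\<^bsub>M\<^esub> c \<oplus>\<^bsub>M\<^esub> a \<odot>\<^bsub>M\<^esub> d"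
      using a by (simp add: carr smult_r_distr)
    with * a show "a \<odot>\<^bsub>M\<^esub> x \<in> C <+>\<^bsub>M\<^esub> D"
      using C.smult_closed D.smult_closed by (auto simp: set_add_eq)
  qed
qed

lemma rmod_hom_add:
  assumes "right_module R A" "f \<in> rmod_hom R A M" "g \<in> rmod_hom R A M"
  shows "(\<lambda>x. f x \<oplus>\<^bsub>M\<^esub> g x) \<in> rmod_hom R A M"
  using assms by (auto simp: rmod_hom_def Pi_iff M.a_ac smult_r_distr)

text \<open>Trivial intersection makes the decomposition c + d unique, so its components are well
  defined and additive. The codomains are \<open>submod M C\<close> and \<open>submod M D\<close>,
  not \<open>M\<close>, so that injectivity of \<open>C\<close> and \<open>D\<close> can later
  extend the maps.\<close>

lemma direct_sum_projections:
  assumes C: "submodule C R M" and D: "submodule D R M" and CD: "C \<inter> D = {\<zero>\<^bsub>M\<^esub>}"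
  obtains p q where "p \<in> rmod_hom R (submod M (C <+>\<^bsub>M\<^esub> D)) (submod M C)"
    and "q \<in> rmod_hom R (submod M (C <+>\<^bsub>M\<^esub> D)) (submod M D)"
    and "\<And>c d. \<lbrakk>c \<in> C; d \<in> D\<rbrakk> \<Longrightarrow> p (c \<oplus>\<^bsub>M\<^esub> d) = c"
    and "\<And>c d. \<lbrakk>c \<in> C; d \<in> D\<rbrakk> \<Longrightarrow> q (c \<oplus>\<^bsub>M\<^esub> d) = d"
proof -
  interpret C: submodule C R M by fact
  interpret D: submodule D R M by fact
  note carr = C.subset[THEN subsetD, simplified] D.subset[THEN subsetD, simplified]
  have uniq: "c = c' \<and> d = d'"
    if "c \<in> C" "d \<in> D" "c' \<in> C" "d' \<in> D" and e: "c \<oplus>\<^bsub>M\<^esub> d = c' \<oplus>\<^bsub>M\<^esub> d'" for c d c' d'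
  proof -
    note [simp] = carr(1)[OF that(1)] carr(2)[OF that(2)] carr(1)[OF that(3)] carr(2)[OF that(4)]
    \<comment> \<open>Two decompositions of one element give c - c' = d' - d. The left side lies in
      \<open>C\<close> and the right side in \<open>D\<close>, so both vanish.\<close>
    have "\<ominus>\<^bsub>M\<^esub> c' \<oplus>\<^bsub>M\<^esub> c = \<ominus>\<^bsub>M\<^esub> c' \<oplus>\<^bsub>M\<^esub> ((c \<oplus>\<^bsub>M\<^esub> d) \<oplus>\<^bsub>M\<^esub> \<ominus>\<^bsub>M\<^esub> d)"
      by (simp add: M.a_assoc M.r_neg)
    also have "\<dots> = d' \<oplus>\<^bsub>M\<^esub> \<ominus>\<^bsub>M\<^esub> d"
      unfolding e by (simp add: M.a_assoc M.r_neg1)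
    finally have *: "\<ominus>\<^bsub>M\<^esub> c' \<oplus>\<^bsub>M\<^esub> c = d' \<oplus>\<^bsub>M\<^esub> \<ominus>\<^bsub>M\<^esub> d" .
    have "\<ominus>\<^bsub>M\<^esub> c' \<oplus>\<^bsub>M\<^esub> c \<in> C" "d' \<oplus>\<^bsub>M\<^esub> \<ominus>\<^bsub>M\<^esub> d \<in> D"
      using that C.m_closed[of "\<ominus>\<^bsub>M\<^esub> c'" c] D.m_closed[of d' "\<ominus>\<^bsub>M\<^esub> d"]
        C.m_inv_closed[of c'] D.m_inv_closed[of d] by (auto simp: a_inv_def)
    with * CD have "\<ominus>\<^bsub>M\<^esub> c' \<oplus>\<^bsub>M\<^esub> c = \<zero>\<^bsub>M\<^esub>" by auto
    then have "c = c'"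
      using carr(1)[OF that(1)] carr(1)[OF that(3)]
      by (metis M.minus_equality M.minus_minus M.a_comm M.a_inv_closed)
    with e show ?thesis by simp
  qed
  \<comment> \<open>The descriptions have a unique solution exactly on C + D; values elsewhere are
    unspecified and never consulted.\<close>
  define p where "p x = (THE c. c \<in> C \<and> (\<exists>d\<in>D. x = c \<oplus>\<^bsub>M\<^esub> d))" for x
  define q where "q x = (THE d. d \<in> D \<and> (\<exists>c\<in>C. x = c \<oplus>\<^bsub>M\<^esub> d))" for x
  have p: "p (c \<oplus>\<^bsub>M\<^esub> d) = c" and q: "q (c \<oplus>\<^bsub>M\<^esub> d) = d" if "c \<in> C" "d \<in> D" for c d
    unfolding p_def q_def using that uniq by (auto intro!: the_equality)
  \<comment> \<open>\<open>p\<close> and \<open>q\<close> can be evaluated only on an element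
    displayed as a member of \<open>C\<close> plus a member of \<open>D\<close>, so a sum of two
    such elements is first regrouped.\<close>
  have pq_sum: "p ((c \<oplus>\<^bsub>M\<^esub> d) \<oplus>\<^bsub>M\<^esub> (c' \<oplus>\<^bsub>M\<^esub> d')) = c \<oplus>\<^bsub>M\<^esub> c'"
      "q ((c \<oplus>\<^bsub>M\<^esub> d) \<oplus>\<^bsub>M\<^esub> (c' \<oplus>\<^bsub>M\<^esub> d')) = d \<oplus>\<^bsub>M\<^esub> d'"
    if "c \<in> C" "d \<in> D" "c' \<in> C" "d' \<in> D" for c d c' d'
  proof -
    have "(c \<oplus>\<^bsub>M\<^esub> d) \<oplus>\<^bsub>M\<^esub> (c' \<oplus>\<^bsub>M\<^esub> d') = (c \<oplus>\<^bsub>M\<^esub> c') \<oplus>\<^bsub>M\<^esub> (d \<oplus>\<^bsub>M\<^esub> d')"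
      using that by (simp add: carr M.a_ac)
    moreover have "c \<oplus>\<^bsub>M\<^esub> c' \<in> C" "d \<oplus>\<^bsub>M\<^esub> d' \<in> D"
      using that C.m_closed D.m_closed by auto
    ultimately show "p ((c \<oplus>\<^bsub>M\<^esub> d) \<oplus>\<^bsub>M\<^esub> (c' \<oplus>\<^bsub>M\<^esub> d')) = c \<oplus>\<^bsub>M\<^esub> c'"
      "q ((c \<oplus>\<^bsub>M\<^esub> d) \<oplus>\<^bsub>M\<^esub> (c' \<oplus>\<^bsub>M\<^esub> d')) = d \<oplus>\<^bsub>M\<^esub> d'"
      by (simp_all only: p q)
  qed
  have pq_smult: "p (a \<odot>\<^bsub>M\<^esub> (c \<oplus>\<^bsub>M\<^esub> d)) = a \<odot>\<^bsub>M\<^esub> c" "q (a \<odot>\<^bsub>M\<^esub> (c \<oplus>\<^bsub>M\<^esub> d)) = a \<odot>\<^bsub>M\<^esub> d"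
    if "a \<in> carrier R" "c \<in> C" "d \<in> D" for a c d
    using that by (auto simp: carr smult_r_distr p q C.smult_closed D.smult_closed)
  have "p \<in> rmod_hom R (submod M (C <+>\<^bsub>M\<^esub> D)) (submod M C)"
    "q \<in> rmod_hom R (submod M (C <+>\<^bsub>M\<^esub> D)) (submod M D)"
    by (auto simp: rmod_hom_def set_add_eq pq_sum pq_smult p q)
  with p q that show thesis by blast
qed

end

section \<open>Injective modules\<close>

text \<open>View the map to be extended as a map into \<open>M\<close>, extend it there, and compose
  with the retraction \<open>p\<close>. The prescribed values lie in \<open>C\<close>, which
  \<open>p\<close> fixes, so they survive the composition.\<close>

lemma injective_rmod_summand:
  fixes U :: "'u::infinite itself" and M :: "('a, 'b, 'm) module_scheme"
  assumes inj: "injective_rmod U R M"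
    and C: "submodule C R M" and p: "p \<in> rmod_hom R M (submod M C)"
    and p_id: "\<And>x. x \<in> C \<Longrightarrow> p x = x"
  shows "injective_rmod U R (submod M C)"
  unfolding injective_rmod_def
proof (intro conjI allI impI)
  have M: "right_module R M" using inj by (simp add: injective_rmod_def)
  then show "right_module R (submod M C)" using C by (rule right_module_submod)
  have CM: "C \<subseteq> carrier M" using submodule.axioms(1)[OF C] subgroup.subset by fastforce
  fix A B :: "('a, 'u) module" and f g
  assume *: "right_module R A \<and> right_module R B \<and> f \<in> rmod_hom R A B \<and>
    inj_on f (carrier A) \<and> g \<in> rmod_hom R A (submod M C)"
  then have "g \<in> rmod_hom R A M" using rmod_hom_submod_mono CM by blast
  with * inj obtain h where h: "h \<in> rmod_hom R B M" "\<forall>x\<in>carrier A. h (f x) = g x"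
    unfolding injective_rmod_def by blast
  have "g x \<in> C" if "x \<in> carrier A" for x
    using * that by (auto simp: rmod_hom_def)
  with h p_id have "\<forall>x\<in>carrier A. p (h (f x)) = g x" by simp
  with rmod_hom_comp[OF h(1) p]
  show "\<exists>h\<in>rmod_hom R B (submod M C). \<forall>x\<in>carrier A. h (f x) = g x" by (intro bexI)
qed

text \<open>A map into a power is a family of maps into the factor: each coordinate is extended by
  self-injectivity, and the extensions are reassembled.\<close>

lemma injective_rmod_free:
  fixes U :: "'u::infinite itself" and R :: "('a, 'r) ring_scheme"
  assumes "injective_rmod U R (regular_rmod R)"
  shows "injective_rmod U R (free_rmod R n)"
  unfolding injective_rmod_def
proof (intro conjI allI impI)
  have R: "ring R" using assms by (simp add: injective_rmod_def right_module_def)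
  then show "right_module R (free_rmod R n)" by (rule right_module_free_rmod)
  fix A B :: "('a, 'u) module" and f g
  assume *: "right_module R A \<and> right_module R B \<and> f \<in> rmod_hom R A B \<and>
    inj_on f (carrier A) \<and> g \<in> rmod_hom R A (free_rmod R n)"
  have gA: "g x \<in> {..<n} \<rightarrow>\<^sub>E carrier R" if "x \<in> carrier A" for x
    using * that by (auto simp: rmod_hom_def free_rmod_def)
  have "\<exists>h\<in>rmod_hom R B (regular_rmod R). \<forall>x\<in>carrier A. h (f x) = g x i" if "i < n" for i
  proof -
    have "(\<lambda>x. g x i) \<in> rmod_hom R A (regular_rmod R)"
      using * that by (auto simp: rmod_hom_def free_rmod_def regular_rmod_def PiE_iff Pi_iff)
    with * assms show ?thesis unfolding injective_rmod_def by blast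
  qed
  then obtain h where h: "\<And>i. i < n \<Longrightarrow> h i \<in> rmod_hom R B (regular_rmod R)"
    "\<And>i x. \<lbrakk>i < n; x \<in> carrier A\<rbrakk> \<Longrightarrow> h i (f x) = g x i" by metis
  have "(\<lambda>x. \<lambda>i\<in>{..<n}. h i x) \<in> rmod_hom R B (free_rmod R n)"
    using h(1) by (auto simp: rmod_hom_def free_rmod_def regular_rmod_def Pi_iff fun_eq_iff)
  \<comment> \<open>Equality must hold at every index, not only below \<open>n\<close>. Outside
    \<open>{..<n}\<close> both sides are \<open>undefined\<close>, since \<open>g x\<close> is
    extensional.\<close>
  moreover have "(\<lambda>i\<in>{..<n}. h i (f x)) = g x" if "x \<in> carrier A" for x
    using h(2) gA[OF that] that by (auto simp: fun_eq_iff PiE_iff extensional_def)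
  ultimately show "\<exists>h\<in>rmod_hom R B (free_rmod R n). \<forall>x\<in>carrier A. h (f x) = g x"
    by (intro bexI) auto
qed

section \<open>Transport of finite modules into the type over which injectivity is tested\<close>

lemma finite_inj_on_infinite:
  assumes "finite A"
  obtains e :: "'a \<Rightarrow> 'u::infinite" where "inj_on e A"
proof -
  obtain B :: "'u set" where "finite B" "card B = card A"
    using infinite_arbitrarily_large[OF infinite_UNIV] by metis
  with assms that show thesis by (metis bij_betw_def finite_same_card_bij)
qed

text \<open>Structure transported along \<open>e\<close>, so that a module with elements in one type
  gets a copy in another. The decoding \<open>d\<close> is meaningful on the image of the carrier,
  which is where the module laws are required.\<close>

definition image_rmod :: "('b \<Rightarrow> 'c) \<Rightarrow> ('a, 'b, 'm) module_scheme \<Rightarrow> ('a, 'c) module"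
  where "image_rmod e M = (let d = the_inv_into (carrier M) e in
    \<lparr>carrier = e ` carrier M, mult = (\<lambda>x y. e (d x \<otimes>\<^bsub>M\<^esub> d y)), one = e \<one>\<^bsub>M\<^esub>,
     zero = e \<zero>\<^bsub>M\<^esub>, add = (\<lambda>x y. e (d x \<oplus>\<^bsub>M\<^esub> d y)), smult = (\<lambda>a x. e (a \<odot>\<^bsub>M\<^esub> d x))\<rparr>)"

lemma image_rmod_simps:
  assumes "inj_on e (carrier M)"
  shows "carrier (image_rmod e M) = e ` carrier M"
    and "\<zero>\<^bsub>image_rmod e M\<^esub> = e \<zero>\<^bsub>M\<^esub>"
    and "\<lbrakk>x \<in> carrier M; y \<in> carrier M\<rbrakk> \<Longrightarrow> e x \<oplus>\<^bsub>image_rmod e M\<^esub> e y = e (x \<oplus>\<^bsub>M\<^esub> y)"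
    and "x \<in> carrier M \<Longrightarrow> a \<odot>\<^bsub>image_rmod e M\<^esub> e x = e (a \<odot>\<^bsub>M\<^esub> x)"
  using assms by (auto simp: image_rmod_def Let_def the_inv_into_f_f)

lemma right_module_image_rmod:
  assumes "right_module R M" and e: "inj_on e (carrier M)"
  shows "right_module R (image_rmod e M)"
proof -
  interpret right_module R M by fact
  note [simp] = image_rmod_simps[OF e]
  have "abelian_group (image_rmod e M)"
  proof (rule abelian_groupI)
    fix X assume "X \<in> carrier (image_rmod e M)"
    then obtain x where "x \<in> carrier M" "X = e x" by auto
    then show "\<exists>Y\<in>carrier (image_rmod e M). Y \<oplus>\<^bsub>image_rmod e M\<^esub> X = \<zero>\<^bsub>image_rmod e M\<^esub>"
      by (intro bexI[of _ "e (\<ominus>\<^bsub>M\<^esub> x)"]) (auto simp: M.l_neg)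
  qed (auto simp: M.a_assoc M.a_comm M.a_lcomm)
  then show ?thesis
    by (intro right_module.intro right_module_axioms.intro R.ring_axioms)
      (auto simp: smult_closed smult_l_distr smult_r_distr smult_assoc smult_one)
qed

text \<open>Finiteness lets the modules be copied into the type over which injectivity is tested.\<close>

lemma injective_rmod_extend:
  fixes U :: "'u::infinite itself"
  assumes inj: "injective_rmod U R I" and M: "right_module R M" "finite (carrier M)"
    and N: "submodule N R M" and g: "g \<in> rmod_hom R (submod M N) I"
  obtains h where "h \<in> rmod_hom R M I" "\<And>x. x \<in> N \<Longrightarrow> h x = g x"
proof -
  obtain e :: "_ \<Rightarrow> 'u" where e: "inj_on e (carrier M)" using finite_inj_on_infinite[OF M(2)] .
  have NM: "N \<subseteq> carrier M" using submodule.axioms(1)[OF N] subgroup.subset by fastforce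
  then have eN: "inj_on e (carrier (submod M N))" using e inj_on_subset by auto
  let ?A = "image_rmod e (submod M N)" and ?B = "image_rmod e M"
  let ?d = "the_inv_into N e"
  have sub: "right_module R (submod M N)" by (rule right_module_submod[OF M(1) N])
  interpret S: right_module R "submod M N" by fact
  have closed: "x \<oplus>\<^bsub>M\<^esub> y \<in> N" if "x \<in> N" "y \<in> N" for x y
    using S.M.a_closed that by simp
  have sclosed: "a \<odot>\<^bsub>M\<^esub> x \<in> N" if "a \<in> carrier R" "x \<in> N" for a x
    using S.smult_closed that by simp
  note A = image_rmod_simps[OF eN, simplified] and B = image_rmod_simps[OF e]
  have d: "?d (e x) = x" if "x \<in> N" for x
    using eN that by (simp add: the_inv_into_f_f)
  \<comment> \<open>Submodule and module are copied along the same \<open>e\<close>, so the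
    inclusion of the copies is the identity map.\<close>
  have "(\<lambda>x. x) \<in> rmod_hom R ?A ?B" "inj_on (\<lambda>x. x) (carrier ?A)"
    using NM by (auto simp: rmod_hom_def A B subset_iff)
  \<comment> \<open>The map on the copy decodes its argument before applying \<open>g\<close>;
    composing the resulting extension with \<open>e\<close> returns to the original module.\<close>
  moreover have "(\<lambda>x. g (?d x)) \<in> rmod_hom R ?A I"
    using g by (auto simp: rmod_hom_def A d closed sclosed Pi_iff)
  moreover note right_module_image_rmod[OF sub eN] right_module_image_rmod[OF M(1) e]
  ultimately obtain h where h: "h \<in> rmod_hom R ?B I" "\<forall>x\<in>carrier ?A. h x = g (?d x)"
    using inj unfolding injective_rmod_def by blast
  have "e \<in> rmod_hom R M ?B" by (auto simp: rmod_hom_def B)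
  from rmod_hom_comp[OF this h(1)] show thesis
    by (rule that) (use h(2) in \<open>auto simp: A d\<close>)
qed

section \<open>Splitting off an essential direct sum of injective submodules\<close>

lemma injective_essential_sum_eq_carrier:
  fixes U :: "'u::infinite itself"
  assumes M: "right_module R M" "finite (carrier M)"
    and C: "submodule C R M" and D: "submodule D R M" and CD: "C \<inter> D = {\<zero>\<^bsub>M\<^esub>}"
    and injC: "injective_rmod U R (submod M C)" and injD: "injective_rmod U R (submod M D)"
    and ess: "essential_submodule R (C <+>\<^bsub>M\<^esub> D) M"
  shows "C <+>\<^bsub>M\<^esub> D = carrier M"
proof -
  interpret right_module R M by fact
  let ?S = "C <+>\<^bsub>M\<^esub> D"
  have S: "submodule ?S R M" by (rule submodule_add[OF C D])
  have sub: "H \<subseteq> carrier M" if "submodule H R M" for H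
    using submodule.axioms(1)[OF that] subgroup.subset by fastforce
  obtain p q where p: "p \<in> rmod_hom R (submod M ?S) (submod M C)"
    and q: "q \<in> rmod_hom R (submod M ?S) (submod M D)"
    and pq: "\<And>c d. \<lbrakk>c \<in> C; d \<in> D\<rbrakk> \<Longrightarrow> p (c \<oplus>\<^bsub>M\<^esub> d) = c"
      "\<And>c d. \<lbrakk>c \<in> C; d \<in> D\<rbrakk> \<Longrightarrow> q (c \<oplus>\<^bsub>M\<^esub> d) = d"
    using direct_sum_projections[OF C D CD] by blast
  \<comment> \<open>Finiteness of \<open>M\<close> enters here: it allows the extension from C + D
    to all of \<open>M\<close> to be taken with \<open>M\<close> outside the test type.\<close>
  obtain p' where p': "p' \<in> rmod_hom R M (submod M C)" "\<And>x. x \<in> ?S \<Longrightarrow> p' x = p x"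
    using injective_rmod_extend[OF injC M S p] by blast
  obtain q' where q': "q' \<in> rmod_hom R M (submod M D)" "\<And>x. x \<in> ?S \<Longrightarrow> q' x = q x"
    using injective_rmod_extend[OF injD M S q] by blast
  \<comment> \<open>On C + D the two components add up to the element again, so \<open>r\<close> is
    the identity there, while all its values lie in C + D.\<close>
  define r where "r x = p' x \<oplus>\<^bsub>M\<^esub> q' x" for x
  have r: "r \<in> rmod_hom R M M"
    unfolding r_def using p'(1) q'(1) sub[OF C] sub[OF D]
    by (intro rmod_hom_add M(1)) (auto intro: rmod_hom_submod_mono)
  have rS: "r x \<in> ?S" if "x \<in> carrier M" for x
    using p'(1) q'(1) that by (auto simp: r_def rmod_hom_def set_add_eq)
  have r_id: "r x = x" if x: "x \<in> ?S" for x
  proof -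
    obtain c d where "c \<in> C" "d \<in> D" "x = c \<oplus>\<^bsub>M\<^esub> d"
      using x unfolding set_add_eq by blast
    then show ?thesis using x by (simp add: r_def p'(2) q'(2) pq)
  qed
  have zeroS: "\<zero>\<^bsub>M\<^esub> \<in> ?S"
    using subgroup.one_closed[OF submodule.axioms(1)[OF S]] by simp
  \<comment> \<open>The kernel of \<open>r\<close>; closure under scalars needs that they send zero
    to zero.\<close>
  define K where "K = {x \<in> carrier M. r x = \<zero>\<^bsub>M\<^esub>}"
  have smult_zero: "a \<odot>\<^bsub>M\<^esub> \<zero>\<^bsub>M\<^esub> = \<zero>\<^bsub>M\<^esub>" if a: "a \<in> carrier R" for a
  proof -
    have "a \<odot>\<^bsub>M\<^esub> \<zero>\<^bsub>M\<^esub> \<oplus>\<^bsub>M\<^esub> a \<odot>\<^bsub>M\<^esub> \<zero>\<^bsub>M\<^esub> = a \<odot>\<^bsub>M\<^esub> \<zero>\<^bsub>M\<^esub>"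
      using smult_r_distr[OF a M.zero_closed M.zero_closed] by simp
    then show ?thesis using smult_closed[OF a M.zero_closed] by (simp add: M.add.l_cancel_one)
  qed
  have K: "submodule K R M"
    by (rule right_submoduleI)
      (use r in \<open>auto simp: K_def r_id[OF zeroS] smult_zero smult_closed rmod_hom_def\<close>)
  \<comment> \<open>An element of both is fixed by \<open>r\<close> and killed by it. Essentiality,
    read contrapositively, then forces the kernel to be zero.\<close>
  have "?S \<inter> K = {\<zero>\<^bsub>M\<^esub>}"
    using zeroS r_id[OF zeroS] by (auto simp: K_def r_id)
  then have K0: "K = {\<zero>\<^bsub>M\<^esub>}"
    using ess K by (auto simp: essential_submodule_def)
  have "x \<in> ?S" if x: "x \<in> carrier M" for x
  proof -
    \<comment> \<open>Since r x lies in C + D, \<open>r\<close> fixes its negative, so x - r x is in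
      the kernel. The kernel being zero, x = r x, a member of C + D.\<close>
    let ?y = "\<ominus>\<^bsub>M\<^esub> r x"
    have rx: "r x \<in> carrier M" using r x by (auto simp: rmod_hom_def)
    have y: "?y \<in> ?S"
      using subgroup.m_inv_closed[OF submodule.axioms(1)[OF S] rS[OF x]] by (simp add: a_inv_def)
    have "r (x \<oplus>\<^bsub>M\<^esub> ?y) = r x \<oplus>\<^bsub>M\<^esub> r ?y"
      using r x rx by (simp add: rmod_hom_def)
    also have "\<dots> = \<zero>\<^bsub>M\<^esub>" using rx by (simp add: r_id[OF y] M.r_neg)
    finally have "x \<oplus>\<^bsub>M\<^esub> ?y \<in> K" using x rx by (simp add: K_def)
    then have "x \<oplus>\<^bsub>M\<^esub> ?y = \<zero>\<^bsub>M\<^esub>" using K0 by simp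
    then have "x = r x" using x rx by (metis M.minus_equality M.minus_minus M.a_inv_closed)
    with rS[OF x] show ?thesis by simp
  qed
  with sub[OF S] show ?thesis by blast
qed

text \<open>\<open>injective_hull\<close> receives only the set C + D, which does not record that
  the sum is direct. Trivial intersection, part of the meaning of E(C \<oplus> D), is therefore a
  separate conjunct.\<close>

theorem theorem4p4:
  fixes R :: "('a, 'r) ring_scheme" and n :: nat and C D :: "(nat \<Rightarrow> 'a) set"
  assumes "finite_frobenius_ring TYPE('u::infinite) R"
    and "n \<ge> 1"
    and "linear_code R n C"
    and "linear_code R n D"
  shows "LCP R n C D \<longleftrightarrow>
    injective_rmod TYPE('u) R (submod (free_rmod R n) C) \<and>
    injective_rmod TYPE('u) R (submod (free_rmod R n) D) \<and>
    C \<inter> D = {\<zero>\<^bsub>free_rmod R n\<^esub>} \<and>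
    injective_hull TYPE('u) R (C <+>\<^bsub>free_rmod R n\<^esub> D) (free_rmod R n)"
proof -
  let ?F = "free_rmod R n"
  \<comment> \<open>Right self-injectivity, contained in the Frobenius hypothesis, passes to the
    power R^n.\<close>
  have inj: "injective_rmod TYPE('u) R ?F"
    using assms(1) by (intro injective_rmod_free)
      (simp add: finite_frobenius_ring_def right_self_injective_def)
  then have F: "right_module R ?F" by (simp add: injective_rmod_def)
  have fin: "finite (carrier ?F)"
    using assms(1) by (auto simp: finite_frobenius_ring_def free_rmod_def intro: finite_PiE)
  have C: "submodule C R ?F" and D: "submodule D R ?F"
    using assms(3,4) by (simp_all add: linear_code_def)
  interpret right_module R ?F by (rule F)
  show ?thesis
  proof
    assume "LCP R n C D"
    then have sum: "C <+>\<^bsub>?F\<^esub> D = carrier ?F" and CD: "C \<inter> D = {\<zero>\<^bsub>?F\<^esub>}"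
      by (simp_all add: LCP_def)
    \<comment> \<open>As C + D is the whole carrier, restricting to it changes nothing, and the
      projections are defined on all of R^n.\<close>
    obtain p q where p: "p \<in> rmod_hom R ?F (submod ?F C)" and q: "q \<in> rmod_hom R ?F (submod ?F D)"
      and pq: "\<And>c d. \<lbrakk>c \<in> C; d \<in> D\<rbrakk> \<Longrightarrow> p (c \<oplus>\<^bsub>?F\<^esub> d) = c"
        "\<And>c d. \<lbrakk>c \<in> C; d \<in> D\<rbrakk> \<Longrightarrow> q (c \<oplus>\<^bsub>?F\<^esub> d) = d"
      using direct_sum_projections[OF C D CD] unfolding sum submod_carrier_self by blast
    have zero: "\<zero>\<^bsub>?F\<^esub> \<in> C" "\<zero>\<^bsub>?F\<^esub> \<in> D" using CD by auto
    have sub: "C \<subseteq> carrier ?F" "D \<subseteq> carrier ?F"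
      using subgroup.subset[OF submodule.axioms(1)[OF C]] subgroup.subset[OF submodule.axioms(1)[OF D]]
      by simp_all
    \<comment> \<open>Evaluate the projection on x + 0, with the zero taken from \<open>D\<close>;
      for \<open>q\<close> the roles are exchanged.\<close>
    have "p x = x" if "x \<in> C" for x
      using pq(1)[OF that zero(2)] that sub by (simp add: subset_iff)
    then have injC: "injective_rmod TYPE('u) R (submod ?F C)"
      by (rule injective_rmod_summand[OF inj C p])
    have "q x = x" if "x \<in> D" for x
      using pq(2)[OF zero(1) that] that sub by (simp add: subset_iff)
    then have injD: "injective_rmod TYPE('u) R (submod ?F D)"
      by (rule injective_rmod_summand[OF inj D q])
    \<comment> \<open>The whole module is essential in itself, because it meets each submodule in
      that submodule.\<close>
    have "carrier ?F \<inter> H = H" if "submodule H R ?F" for H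
      using subgroup.subset[OF submodule.axioms(1)[OF that]] by auto
    then have "essential_submodule R (C <+>\<^bsub>?F\<^esub> D) ?F"
      using submodule_carrier by (simp add: essential_submodule_def sum)
    with inj injC injD CD show "injective_rmod TYPE('u) R (submod ?F C) \<and>
      injective_rmod TYPE('u) R (submod ?F D) \<and> C \<inter> D = {\<zero>\<^bsub>?F\<^esub>} \<and>
      injective_hull TYPE('u) R (C <+>\<^bsub>?F\<^esub> D) ?F"
      by (simp add: injective_hull_def)
  next
    assume "injective_rmod TYPE('u) R (submod ?F C) \<and>
      injective_rmod TYPE('u) R (submod ?F D) \<and> C \<inter> D = {\<zero>\<^bsub>?F\<^esub>} \<and>
      injective_hull TYPE('u) R (C <+>\<^bsub>?F\<^esub> D) ?F"
    then show "LCP R n C D"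
      using injective_essential_sum_eq_carrier[OF F fin C D] by (auto simp: LCP_def injective_hull_def)
  qed
qed

end
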